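(* Let $G=(V,E)$ be a temporal graph with $m=|E|$ given as a stream $\tau$ in strictly increasing timestamp order, let $\delta>0$, and assume there is a constant $C_0$ with $|\mathcal{T}_i|=C_0|\mathcal{T}_j|$ for all $i,j\in[8]$. Consider STEP run with an $\alpha$-noisy $K$-ranking predictor $\mathcal{O}_K$ with $\alpha\ge1$ and $K=o(m_\delta)$, and let $\varepsilon>0$. There exist constants $C$ and $\gamma\in(0,1/2)$ such that, if $p\ge \frac{C\sqrt{\Delta_\alpha m_\delta}}{\varepsilon|\mathcal{T}_i|^{1/2-\gamma}}$, then STEP with predictor $\mathcal{O}_K$ is a one-pass streaming algorithm for which $\Pr[\exists i\in[8]:|c_i-|\mathcal{T}_i||\ge\varepsilon|\mathcal{T}_i|]\le1/3$, using $O\!\left(\varepsilon^{-1}m_\delta^{3/2}\sqrt{\Delta_\alpha}/|\mathcal{T}_i|^{1/2-\gamma}\right)$ memory in expectation.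
   Context: A temporal graph is $G=(V,E)$ with directed temporal edges $(u,v,t)$, $u\neq v$, $t\in\mathbb{R}^+$. A temporal triangle is a directed 3-vertex, 3-edge triangle together with an ordering $\sigma$ of its edges; there are eight, $T_1,\dots,T_8$. A sequence $\langle (u_1,v_1,t_1),(u_2,v_2,t_2),(u_3,v_3,t_3)\rangle$ of edges of $E$ with $t_1<t_2<t_3$ is a $\delta$-instance of $T$ (whose $\sigma$-ordered edges are $(x_j,y_j)$) if a vertex bijection $f$ has $f(u_j)=x_j,f(v_j)=y_j$ for $j=1,2,3$ and $t_3-t_1\le\delta$. $\mathcal{T}_i$ is the set of $\delta$-instances of $T_i$. $m_\delta$ is the maximum number of edges of $\tau$ occurring in any time window of length $\delta$. Algorithm STEP (input stream $\tau$, $\delta$, predictor $\mathcal{O}:E\to\{0,1\}$, $p\in(0,1]$): keep sets $H,S_L$ (initially empty) and counters $c_{i,0},c_{i,1},c_{i,2}$ (initially 0). For each $e=(u,v,t)$ in stream order: remove stored edges with timestamp $<t-\delta$; for each pair of stored edges in $H\cup S_L$ forming with $e$ (as last edge) a $\delta$-instance of $T_i$, increment $c_{i,0}$, $c_{i,1}$ or $c_{i,2}$ according as 0, 1 or 2 of the pair lie in $H$; then if $\mathcal{O}(e)=1$ add $e$ to $H$, else add $e$ to $S_L$ independently with probability $p$. Output $c_i=c_{i,0}/p^2+c_{i,1}/p+c_{i,2}$. For $e\in E$ let $W(e)$ be the total number of $\delta$-instances (over all eight types) containing $e$; let $\langle e_1,\dots,e_m\rangle$ be $E$ ordered by non-increasing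 $W$ (ties broken arbitrarily), $e_{\prec_j}$ the edge in position $j$. Noisy ranking predictor: for $K>0$ and $0\le\alpha\le\min\{m-K+1,K-1\}$, let $\Pi_{(\alpha,K)}$ be the set of permutations of $\{1,\dots,m\}$ that map each of the blocks $\{1,\dots,K-\alpha-1\}$, $\{K-\alpha,\dots,K+\alpha\}$, $\{K+\alpha+1,\dots,m\}$ to itself. An $\alpha$-noisy $K$-ranking predictor draws $\pi$ uniformly from $\Pi_{(\alpha,K)}$ (independently of STEP's coin flips), forms the permuted ordering $\langle e_{\pi_1},\dots,e_{\pi_m}\rangle$, and sets $\mathcal{O}_K(e)=1$ iff $e$ is among its first $K$ edges. Let $\Delta=\max_{1\le j\le m-1}\{W(e_{\prec_j})-W(e_{\prec_{j+1}})\}$ and $\Delta_\alpha=\Delta(\alpha+1)$.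
   Formalization: Assumes |T_i|>0 and Δ>0; reads the balance condition as |T_i|≤C_0|T_j|; the memory bound (expectation at each time) is for p of the order of the threshold and is O(K+bound), or O(bound) if K=O(p·m_δ), since K=o(m_δ) alone does not suffice. *)

theory Defs
  imports
    "HOL-Probability.Probability"
    "HOL-Combinatorics.Permutations"
    "HOL-Library.Landau_Symbols"
begin

section \<open>Temporal graphs, streams and temporal triangles\<close>

type_synonym 'v tedge = "'v \<times> 'v \<times> real"

definition src :: "'v tedge \<Rightarrow> 'v" where
  "src e = fst e"

definition dst :: "'v tedge \<Rightarrow> 'v" where
  "dst e = fst (snd e)"

definition time :: "'v tedge \<Rightarrow> real" where
  "time e = snd (snd e)"

definition temporal_graph :: "'v set \<Rightarrow> 'v tedge set \<Rightarrow> bool" where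
  "temporal_graph V E \<longleftrightarrow> finite V \<and> finite E \<and>
     (\<forall>e\<in>E. src e \<in> V \<and> dst e \<in> V \<and> src e \<noteq> dst e \<and> time e > 0)"

definition is_stream :: "'v tedge set \<Rightarrow> 'v tedge list \<Rightarrow> bool" where
  "is_stream E \<tau> \<longleftrightarrow> set \<tau> = E \<and> sorted_wrt (\<lambda>e e'. time e < time e') \<tau>"

text \<open>The list gives the edges in the order \<open>\<sigma>\<close>. Up to renaming of the vertices the first edge is
  \<open>0 \<rightarrow> 1\<close>; the second edge joins the vertex \<open>2\<close> to \<open>0\<close> or to \<open>1\<close>, in either direction; the third
  edge joins the remaining pair of vertices, in either direction.\<close>

definition temporal_triangle :: "nat \<Rightarrow> (nat \<times> nat) list" where
  "temporal_triangle i =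
    [[(0,1), (0,2), (1,2)], [(0,1), (0,2), (2,1)],
     [(0,1), (2,0), (1,2)], [(0,1), (2,0), (2,1)],
     [(0,1), (1,2), (0,2)], [(0,1), (1,2), (2,0)],
     [(0,1), (2,1), (0,2)], [(0,1), (2,1), (2,0)]] ! (i - 1)"

lemma triangle_exists:
  fixes T :: "(nat \<times> nat) list"
  assumes "length T = 3" and im: "(\<lambda>(x, y). {x, y}) ` set T = {{0,1}, {0,2}, {1,2}}"
  shows "\<exists>i. i \<in> {1..8} \<and>
    (\<exists>f. bij_betw f {0,1,2} {0,1,2::nat} \<and> map (map_prod f f) T = temporal_triangle i)"
proof -
  obtain a b c d e g where T: "T = [(a,b),(c,d),(e,g)]"
    using assms(1) by (auto simp: length_Suc_conv eval_nat_numeral)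
  have im': "{{a,b},{c,d},{e,g}} = {{0,1}, {0,2}, {1,2::nat}}" using im unfolding T by simp
  have s: "{a,b} \<in> {{0,1}, {0,2}, {1,2}}" "{c,d} \<in> {{0,1}, {0,2}, {1,2}}" "{e,g} \<in> {{0,1}, {0,2}, {1,2}}"
    by (simp_all only: im'[symmetric] insertI1 insertI2)
  have d: "{a,b} \<noteq> {c,d}" "{a,b} \<noteq> {e,g}" "{c,d} \<noteq> {e,g}"
  proof -
    have "card {{a,b},{c,d},{e,g}} = 3" unfolding im' by (simp add: doubleton_eq_iff)
    thus "{a,b} \<noteq> {c,d}" "{a,b} \<noteq> {e,g}" "{c,d} \<noteq> {e,g}"
      by (auto simp: card_insert_if split: if_splits)
  qed
  define f where "f = (\<lambda>x. if x = a then 0 else if x = b then 1 else 2::nat)"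
  have f: "bij_betw f {0,1,2} {0,1,2::nat}" 
    using s(1) unfolding f_def bij_betw_def inj_on_def by (auto simp: doubleton_eq_iff)
  have im8: "temporal_triangle ` {1..8} =
    {[(0,1), (0,2), (1,2)], [(0,1), (0,2), (2,1)], [(0,1), (2,0), (1,2)], [(0,1), (2,0), (2,1)],
     [(0,1), (1,2), (0,2)], [(0,1), (1,2), (2,0)], [(0,1), (2,1), (0,2)], [(0,1), (2,1), (2,0)]}"
  proof -
    have "{1..8::nat} = {1,2,3,4,5,6,7,8}" by auto
    then show ?thesis by (simp add: temporal_triangle_def)
  qed
  have pairs: "(x = 0 \<and> y = 1) \<or> (x = 1 \<and> y = 0) \<or> (x = 0 \<and> y = 2) \<or> (x = 2 \<and> y = 0) \<or>
      (x = 1 \<and> y = 2) \<or> (x = 2 \<and> y = (1::nat))"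
    if "{x, y} \<in> {{0,1}, {0,2}, {1,2}}" for x y
    using that by (simp add: doubleton_eq_iff)
  have "map (map_prod f f) T \<in> temporal_triangle ` {1..8}"
    unfolding im8 T f_def using pairs[OF s(1)] pairs[OF s(2)] pairs[OF s(3)] d
    by (elim disjE conjE) (simp_all add: insert_commute)
  thus ?thesis using f by auto
qed

lemma temporal_triangle_inj: "inj_on temporal_triangle {1..8}"
proof -
  have "{1..8::nat} = {1,2,3,4,5,6,7,8}" by auto
  then show ?thesis by (simp add: temporal_triangle_def)
qed

lemma temporal_triangle_form:
  assumes "i \<in> {1..8}"
  shows "\<exists>x y z w. temporal_triangle i = [(0,1), (x,y), (z,w)] \<and> {x,y,z,w} \<subseteq> {0,1,2}"
proof -
  have "{1..8::nat} = {1,2,3,4,5,6,7,8}" by auto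
  then have "\<forall>i\<in>{1..8}. \<exists>x y z w. temporal_triangle i = [(0,1), (x,y), (z,w)] \<and> {x,y,z,w} \<subseteq> {0,1,2}"
    by (simp add: temporal_triangle_def)
  with assms show ?thesis by (rule bspec[rotated])
qed

lemma triangle_unique:
  assumes i: "i \<in> {1..8}" and j: "j \<in> {1..8}"
    and f: "inj_on f {0,1,2::nat}" and g: "inj_on g {0,1,2::nat}"
    and T: "set (concat (map (\<lambda>(x,y). [x,y]) T)) \<subseteq> {0,1,2}"
    and fT: "map (map_prod f f) T = temporal_triangle i"
    and gT: "map (map_prod g g) T = temporal_triangle j"
  shows "i = j"
proof -
  obtain x y z w where i': "temporal_triangle i = [(0,1), (x,y), (z,w)]" "{x,y,z,w} \<subseteq> {0,1,2}"
    using temporal_triangle_form[OF i] by blast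
  obtain x' y' z' w' where j': "temporal_triangle j = [(0,1), (x',y'), (z',w')]" "{x',y',z',w'} \<subseteq> {0,1,2}"
    using temporal_triangle_form[OF j] by blast
  have "length T = 3"
    using arg_cong[OF fT, of length] i'(1) by simp
  then obtain a b c d e h where T': "T = [(a,b),(c,d),(e,h)]"
    by (auto simp: length_Suc_conv eval_nat_numeral)
  have f0: "f a = 0" "f b = 1" and g0: "g a = 0" "g b = 1"
    using fT gT unfolding T' i'(1) j'(1) by simp_all
  have "f c = x" "f d = y" "f e = z" "f h = w" "g c = x'" "g d = y'" "g e = z'" "g h = w'"
    using fT gT unfolding T' i'(1) j'(1) by simp_all
  then have "f ` {c,d,e,h} = {x,y,z,w}" "g ` {c,d,e,h} = {x',y',z',w'}"
    by (simp_all only: image_insert image_empty)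
  then have vals: "f v \<in> {0,1,2}" "g v \<in> {0,1,2}" if "v \<in> {c,d,e,h}" for v
    using imageI[OF that, of f] imageI[OF that, of g] i'(2) j'(2)
    by (simp_all only: subsetD)
  have dom: "v \<in> {0,1,2}" if "v \<in> {a,b,c,d,e,h}" for v
    using that T unfolding T' by auto
  have eq: "f v = g v" if v: "v \<in> {c,d,e,h}" for v
  proof -
    have v': "v \<in> {0,1,2}" "a \<in> {0,1,2}" "b \<in> {0,1,2}"
      using v dom by simp_all
    have "f v = 0 \<longleftrightarrow> g v = 0"
      using inj_on_eq_iff[OF f v'(1,2)] inj_on_eq_iff[OF g v'(1,2)] f0 g0 by simp
    moreover have "f v = 1 \<longleftrightarrow> g v = 1"
      using inj_on_eq_iff[OF f v'(1,3)] inj_on_eq_iff[OF g v'(1,3)] f0 g0 by simp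
    ultimately show ?thesis
      using vals[OF v] by auto
  qed
  have "temporal_triangle i = temporal_triangle j"
    unfolding fT[symmetric] gT[symmetric] T' using f0 g0 eq by simp
  then show ?thesis
    using inj_onD[OF temporal_triangle_inj _ i j] by blast
qed

lemma triangle_complete:
  fixes T :: "(nat \<times> nat) list"
  assumes "length T = 3" and "(\<lambda>(x, y). {x, y}) ` set T = {{0,1}, {0,2}, {1,2}}"
  shows "\<exists>!i. i \<in> {1..8} \<and>
    (\<exists>f. bij_betw f {0,1,2} {0,1,2::nat} \<and> map (map_prod f f) T = temporal_triangle i)"
proof -
  obtain i f where i: "i \<in> {1..8}" "bij_betw f {0,1,2} {0,1,2::nat}" "map (map_prod f f) T = temporal_triangle i"
    using triangle_exists[OF assms] by blast
  have "\<Union> ((\<lambda>(x, y). {x, y}) ` set T) = {0,1,2}"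
    unfolding assms(2) by auto
  moreover have "set (concat (map (\<lambda>(x,y). [x,y]) T)) = \<Union> ((\<lambda>(x, y). {x, y}) ` set T)"
    by auto
  ultimately have sub: "set (concat (map (\<lambda>(x,y). [x,y]) T)) \<subseteq> {0,1,2}"
    by simp
  show ?thesis
  proof (rule ex1I[of _ i])
    show "i \<in> {1..8} \<and> (\<exists>f. bij_betw f {0,1,2} {0,1,2::nat} \<and> map (map_prod f f) T = temporal_triangle i)"
      using i by blast
  next
    fix j
    assume "j \<in> {1..8} \<and> (\<exists>f. bij_betw f {0,1,2} {0,1,2::nat} \<and> map (map_prod f f) T = temporal_triangle j)"
    then obtain g where "j \<in> {1..8}" "bij_betw g {0,1,2} {0,1,2::nat}" "map (map_prod g g) T = temporal_triangle j"
      by blast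
    then show "j = i"
      using triangle_unique[of j i g f T] i sub by (auto simp: bij_betw_def)
  qed
qed

definition is_instance :: "real \<Rightarrow> (nat \<times> nat) list \<Rightarrow> 'v tedge \<times> 'v tedge \<times> 'v tedge \<Rightarrow> bool" where
  "is_instance \<delta> T = (\<lambda>(e\<^sub>1, e\<^sub>2, e\<^sub>3).
     time e\<^sub>1 < time e\<^sub>2 \<and> time e\<^sub>2 < time e\<^sub>3 \<and> time e\<^sub>3 - time e\<^sub>1 \<le> \<delta> \<and>
     (\<exists>f. bij_betw f (\<Union>e\<in>{e\<^sub>1, e\<^sub>2, e\<^sub>3}. {src e, dst e}) {0, 1, 2} \<and>
          map (\<lambda>e. (f (src e), f (dst e))) [e\<^sub>1, e\<^sub>2, e\<^sub>3] = T))"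

definition instances :: "real \<Rightarrow> 'v tedge set \<Rightarrow> nat \<Rightarrow> ('v tedge \<times> 'v tedge \<times> 'v tedge) set" where
  "instances \<delta> E i = {x \<in> E \<times> E \<times> E. is_instance \<delta> (temporal_triangle i) x}"

definition num_instances :: "real \<Rightarrow> 'v tedge set \<Rightarrow> nat \<Rightarrow> nat" where
  "num_instances \<delta> E i = card (instances \<delta> E i)"

definition window_max :: "real \<Rightarrow> 'v tedge set \<Rightarrow> nat" where
  "window_max \<delta> E = Max (range (\<lambda>t. card {e \<in> E. t \<le> time e \<and> time e \<le> t + \<delta>}))"


section \<open>STEP\<close>

text \<open>The counter \<open>c\<^sub>i\<^sub>,\<^sub>j\<close> is \<open>counter st i j\<close>.\<close>

record 'v step_state =
  heavy :: "'v tedge set"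
  light :: "'v tedge set"
  counter :: "nat \<Rightarrow> nat \<Rightarrow> nat"

definition step_init :: "'v step_state" where
  "step_init = \<lparr>heavy = {}, light = {}, counter = (\<lambda>i j. 0)\<rparr>"

text \<open>A pair of stored edges is counted once, since the definition of an instance fixes the
  temporal order of its edges.\<close>

definition step_edge ::
  "real \<Rightarrow> ('v tedge \<Rightarrow> bool) \<Rightarrow> real \<Rightarrow> 'v tedge \<Rightarrow> 'v step_state \<Rightarrow> 'v step_state pmf" where
  "step_edge \<delta> \<O> p e st =
    (let H = {e' \<in> heavy st. \<not> time e' < time e - \<delta>};
         S = {e' \<in> light st. \<not> time e' < time e - \<delta>};
         c = (\<lambda>i j. counter st i j +
               card {(a, b). a \<in> H \<union> S \<and> b \<in> H \<union> S \<and> is_instance \<delta> (temporal_triangle i) (a, b, e) \<and>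
                             card ({a, b} \<inter> H) = j})
     in if \<O> e then return_pmf \<lparr>heavy = insert e H, light = S, counter = c\<rparr>
        else map_pmf (\<lambda>keep. \<lparr>heavy = H, light = (if keep then insert e S else S), counter = c\<rparr>)
               (bernoulli_pmf p))"

definition step_run ::
  "real \<Rightarrow> ('v tedge \<Rightarrow> bool) \<Rightarrow> real \<Rightarrow> 'v tedge list \<Rightarrow> 'v step_state pmf" where
  "step_run \<delta> \<O> p \<tau> = fold (\<lambda>e M. bind_pmf M (step_edge \<delta> \<O> p e)) \<tau> (return_pmf step_init)"

definition estimate :: "real \<Rightarrow> 'v step_state \<Rightarrow> nat \<Rightarrow> real" where
  "estimate p st i = counter st i 0 / p\<^sup>2 + counter st i 1 / p + counter st i 2"

text \<open>One unit for each stored edge and for each of the \<open>8 \<cdot> 3\<close> counters.\<close>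

definition memory :: "'v step_state \<Rightarrow> nat" where
  "memory st = card (heavy st \<union> light st) + 24"


section \<open>Noisy ranking predictors\<close>

definition weight :: "real \<Rightarrow> 'v tedge set \<Rightarrow> 'v tedge \<Rightarrow> nat" where
  "weight \<delta> E e = (\<Sum>i\<in>{1..8}. card {(e\<^sub>1, e\<^sub>2, e\<^sub>3) \<in> instances \<delta> E i. e \<in> {e\<^sub>1, e\<^sub>2, e\<^sub>3}})"

definition weight_ordering :: "real \<Rightarrow> 'v tedge set \<Rightarrow> 'v tedge list \<Rightarrow> bool" where
  "weight_ordering \<delta> E es \<longleftrightarrow> set es = E \<and> distinct es \<and>
     sorted_wrt (\<lambda>e e'. weight \<delta> E e \<ge> weight \<delta> E e') es"

text \<open>Positions are numbered from \<open>1\<close>, list entries from \<open>0\<close>.\<close>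

definition max_gap :: "real \<Rightarrow> 'v tedge set \<Rightarrow> 'v tedge list \<Rightarrow> real" where
  "max_gap \<delta> E es =
     Max ((\<lambda>j. real (weight \<delta> E (es ! (j - 1))) - real (weight \<delta> E (es ! j))) ` {1..length es - 1})"

text \<open>For \<open>K + \<alpha> = m + 1\<close> the middle block contains the point \<open>m + 1\<close>, which is fixed by every
  permutation of \<open>{1..m}\<close>.\<close>

definition noisy_perms :: "nat \<Rightarrow> nat \<Rightarrow> nat \<Rightarrow> (nat \<Rightarrow> nat) set" where
  "noisy_perms m \<alpha> K = {\<pi>. \<pi> permutes {1..m} \<and>
     \<pi> ` {1..K - \<alpha> - 1} = {1..K - \<alpha> - 1} \<and>
     \<pi> ` {K - \<alpha>..K + \<alpha>} = {K - \<alpha>..K + \<alpha>} \<and>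
     \<pi> ` {K + \<alpha> + 1..m} = {K + \<alpha> + 1..m}}"

definition ranking_predictor :: "'v tedge list \<Rightarrow> nat \<Rightarrow> (nat \<Rightarrow> nat) \<Rightarrow> 'v tedge \<Rightarrow> bool" where
  "ranking_predictor es K \<pi> e \<longleftrightarrow> (\<exists>j\<in>{1..K}. e = es ! (\<pi> j - 1))"

definition noisy_step ::
  "real \<Rightarrow> 'v tedge list \<Rightarrow> nat \<Rightarrow> nat \<Rightarrow> real \<Rightarrow> 'v tedge list \<Rightarrow> 'v step_state pmf" where
  "noisy_step \<delta> es \<alpha> K p \<tau> =
     bind_pmf (pmf_of_set (noisy_perms (length es) \<alpha> K))
       (\<lambda>\<pi>. step_run \<delta> (ranking_predictor es K \<pi>) p \<tau>)"

text \<open>The expectation is taken at each point of the stream; a run on a prefix of the stream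
  is the state of the algorithm at that point (the predictor still refers to the whole graph).\<close>

definition expected_memory ::
  "real \<Rightarrow> 'v tedge list \<Rightarrow> nat \<Rightarrow> nat \<Rightarrow> real \<Rightarrow> 'v tedge list \<Rightarrow> real" where
  "expected_memory \<delta> es \<alpha> K p \<tau> =
     Max ((\<lambda>k. measure_pmf.expectation (noisy_step \<delta> es \<alpha> K p (take k \<tau>)) (\<lambda>st. real (memory st)))
          ` {..length \<tau>})"

end

theory Submission
  imports Defs
begin

text \<open>
  With \<open>\<gamma> = 1/4\<close> the bound on \<open>p\<close> is strong enough for every predictor. An edge is first or second
  in at most \<open>D = min T\<^sub>i (2 m\<^sub>\<delta>\<^sup>2) \<le> sqrt (2 T\<^sub>i) m\<^sub>\<delta>\<close> instances of \<open>T\<^sub>i\<close>, and the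
  estimators of two instances are correlated only if their first two edges overlap, with covariance at
  most \<open>1/p\<^sup>2\<close>. Hence the variance of \<open>c\<^sub>i\<close> is at most \<open>2 T\<^sub>i D / p\<^sup>2\<close>, which is below
  \<open>(\<epsilon> T\<^sub>i)\<^sup>2 / 24\<close>; Chebyshev's inequality and a union bound over the eight types give accuracy.
  At any time the stored edges lie in one window, so in expectation at most \<open>K + p m\<^sub>\<delta>\<close> are stored.
\<close>

text \<open>The final state of STEP when the coin of each edge is fixed in advance by \<open>B\<close>. Edges that have
  expired by the end of the stream still count for the counters.\<close>

definition coin_state ::
  "real \<Rightarrow> ('v tedge \<Rightarrow> bool) \<Rightarrow> 'v tedge list \<Rightarrow> ('v tedge \<Rightarrow> bool) \<Rightarrow> 'v step_state" where
  "coin_state \<delta> \<O> \<tau> B =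
    \<lparr>heavy = {x \<in> set \<tau>. \<O> x \<and> \<not> time x < time (last \<tau>) - \<delta>},
     light = {x \<in> set \<tau>. \<not> \<O> x \<and> B x \<and> \<not> time x < time (last \<tau>) - \<delta>},
     counter = (\<lambda>i j. card {(a, b, c). (a, b, c) \<in> instances \<delta> (set \<tau>) i \<and>
       (\<O> a \<or> B a) \<and> (\<O> b \<or> B b) \<and> card ({a, b} \<inter> Collect \<O>) = j})\<rparr>"

lemma finite_instances: "finite E \<Longrightarrow> finite (instances \<delta> E i)"
  by (rule finite_subset[of _ "E \<times> E \<times> E"]) (auto simp: instances_def)

lemma instancesD:
  assumes "(a, b, c) \<in> instances \<delta> E i"
  shows "a \<in> E" "b \<in> E" "c \<in> E" "time a < time b" "time b < time c" "time c - time a \<le> \<delta>"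
  using assms by (auto simp: instances_def is_instance_def)

lemma instances_insert_last:
  assumes "\<And>x. x \<in> S \<Longrightarrow> time x < time e"
  shows "instances \<delta> (insert e S) i =
    instances \<delta> S i \<union> {(a, b, c). a \<in> S \<and> b \<in> S \<and> c = e \<and> is_instance \<delta> (temporal_triangle i) (a, b, e)}"
  using assms by (fastforce simp: instances_def is_instance_def)

lemma step_edge_coin_state:
  fixes \<tau> :: "'v tedge list"
  assumes sorted: "sorted_wrt (\<lambda>e e'. time e < time e') (\<tau> @ [e])" and "\<delta> > 0"
  shows "step_edge \<delta> \<O> p e (coin_state \<delta> \<O> \<tau> B) =
    map_pmf (\<lambda>k. coin_state \<delta> \<O> (\<tau> @ [e]) (B(e := k))) (bernoulli_pmf p)"
proof -
  have before: "time x < time e" if "x \<in> set \<tau>" for x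
    using sorted that by (auto simp: sorted_wrt_append)
  have e: "e \<notin> set \<tau>" using before by blast
  have last: "time x < time (last \<tau>) - \<delta> \<Longrightarrow> time x < time e - \<delta>" if "x \<in> set \<tau>" for x
  proof -
    have "last \<tau> \<in> set \<tau>" using that by (cases \<tau>) auto
    from before[OF this] show "time x < time (last \<tau>) - \<delta> \<Longrightarrow> time x < time e - \<delta>" by simp
  qed
  define H where "H = {x \<in> heavy (coin_state \<delta> \<O> \<tau> B). \<not> time x < time e - \<delta>}"
  define S where "S = {x \<in> light (coin_state \<delta> \<O> \<tau> B). \<not> time x < time e - \<delta>}"
  have H: "H = {x \<in> set \<tau>. \<O> x \<and> \<not> time x < time e - \<delta>}"
    using last by (auto simp: H_def coin_state_def)
  have S: "S = {x \<in> set \<tau>. \<not> \<O> x \<and> B x \<and> \<not> time x < time e - \<delta>}"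
    using last by (auto simp: S_def coin_state_def)
  have counter: "counter (coin_state \<delta> \<O> \<tau> B) i j +
      card {(a, b). a \<in> H \<union> S \<and> b \<in> H \<union> S \<and> is_instance \<delta> (temporal_triangle i) (a, b, e) \<and>
        card ({a, b} \<inter> H) = j} = counter (coin_state \<delta> \<O> (\<tau> @ [e]) (B(e := k))) i j" for i j k
  proof -
    let ?P = "\<lambda>a b. (\<O> a \<or> B a) \<and> (\<O> b \<or> B b) \<and> card ({a, b} \<inter> Collect \<O>) = j"
    define old where "old = {(a, b, c). (a, b, c) \<in> instances \<delta> (set \<tau>) i \<and> ?P a b}"
    define new where "new = {(a, b). a \<in> H \<union> S \<and> b \<in> H \<union> S \<and>
      is_instance \<delta> (temporal_triangle i) (a, b, e) \<and> card ({a, b} \<inter> H) = j}"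
    have int: "{a, b} \<inter> H = {a, b} \<inter> Collect \<O>" if "a \<in> H \<union> S" "b \<in> H \<union> S" for a b
      using that by (auto simp: H S)
    have new: "new = {(a, b). a \<in> set \<tau> \<and> b \<in> set \<tau> \<and>
      is_instance \<delta> (temporal_triangle i) (a, b, e) \<and> ?P a b}"
    proof -
      have "(a \<in> H \<union> S \<and> b \<in> H \<union> S \<and> is_instance \<delta> (temporal_triangle i) (a, b, e) \<and>
          card ({a, b} \<inter> H) = j) \<longleftrightarrow> (a \<in> set \<tau> \<and> b \<in> set \<tau> \<and>
          is_instance \<delta> (temporal_triangle i) (a, b, e) \<and> ?P a b)" for a b
      proof (cases "a \<in> set \<tau> \<and> b \<in> set \<tau> \<and> is_instance \<delta> (temporal_triangle i) (a, b, e)")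
        case True
        then have "a \<in> H \<union> S \<longleftrightarrow> \<O> a \<or> B a" "b \<in> H \<union> S \<longleftrightarrow> \<O> b \<or> B b"
          by (auto simp: H S is_instance_def)
        with True int[of a b] show ?thesis by metis
      next
        case False
        have "H \<union> S \<subseteq> set \<tau>" by (auto simp: H S)
        with False show ?thesis by blast
      qed
      then show ?thesis by (simp only: new_def)
    qed
    have "{(a, b, c). (a, b, c) \<in> instances \<delta> (set (\<tau> @ [e])) i \<and>
       (\<O> a \<or> (B(e := k)) a) \<and> (\<O> b \<or> (B(e := k)) b) \<and> card ({a, b} \<inter> Collect \<O>) = j}
       = old \<union> (\<lambda>(a, b). (a, b, e)) ` new"
    proof -
      have "set (\<tau> @ [e]) = insert e (set \<tau>)" by simp
      have "(B(e := k)) x = B x" if "x \<in> set \<tau>" for x using e that by auto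
      then have "(\<O> a \<or> (B(e := k)) a) \<longleftrightarrow> (\<O> a \<or> B a)" if "a \<in> set \<tau>" for a
        using that by simp
      moreover have "a \<in> set \<tau>" "b \<in> set \<tau>" if "(a, b, c) \<in> instances \<delta> (insert e (set \<tau>)) i" for a b c
        using that instancesD[OF that] before e by fastforce+
      ultimately have "(a, b, c) \<in> instances \<delta> (insert e (set \<tau>)) i \<and>
       (\<O> a \<or> (B(e := k)) a) \<and> (\<O> b \<or> (B(e := k)) b) \<and> card ({a, b} \<inter> Collect \<O>) = j \<longleftrightarrow>
       (a, b, c) \<in> instances \<delta> (insert e (set \<tau>)) i \<and> ?P a b" for a b c
        by blast
      then have "{(a, b, c). (a, b, c) \<in> instances \<delta> (set (\<tau> @ [e])) i \<and>
       (\<O> a \<or> (B(e := k)) a) \<and> (\<O> b \<or> (B(e := k)) b) \<and> card ({a, b} \<inter> Collect \<O>) = j} =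
       {(a, b, c). (a, b, c) \<in> instances \<delta> (insert e (set \<tau>)) i \<and> ?P a b}"
        by (simp only: \<open>set (\<tau> @ [e]) = insert e (set \<tau>)\<close>)
      also have "\<dots> = old \<union> (\<lambda>(a, b). (a, b, e)) ` new"
        by (subst instances_insert_last) (auto simp: old_def new before)
      finally show ?thesis .
    qed
    moreover have "finite old" 
      by (rule finite_subset[OF _ finite_instances[of "set \<tau>" \<delta> i]]) (auto simp: old_def)
    moreover have "finite new"
      by (rule finite_subset[of _ "set \<tau> \<times> set \<tau>"]) (auto simp: new)
    moreover have "old \<inter> (\<lambda>(a, b). (a, b, e)) ` new = {}"
      using e by (auto simp: old_def dest: instancesD)
    moreover have "inj_on (\<lambda>(a, b). (a, b, e)) new" by (auto simp: inj_on_def)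
    ultimately have "counter (coin_state \<delta> \<O> (\<tau> @ [e]) (B(e := k))) i j = card old + card new"
      by (simp add: coin_state_def card_Un_disjoint card_image)
    then show ?thesis by (simp add: coin_state_def old_def new_def)
  qed
  have heavy: "heavy (coin_state \<delta> \<O> (\<tau> @ [e]) (B(e := k))) = (if \<O> e then insert e H else H)" for k
    using \<open>\<delta> > 0\<close> by (auto simp: coin_state_def H)
  have light: "light (coin_state \<delta> \<O> (\<tau> @ [e]) (B(e := k))) = (if \<not> \<O> e \<and> k then insert e S else S)" for k
    using \<open>\<delta> > 0\<close> e by (auto simp: coin_state_def S)
  have state: "coin_state \<delta> \<O> (\<tau> @ [e]) (B(e := k)) =
      \<lparr>heavy = if \<O> e then insert e H else H, light = if \<not> \<O> e \<and> k then insert e S else S,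
       counter = (\<lambda>i j. counter (coin_state \<delta> \<O> \<tau> B) i j +
      card {(a, b). a \<in> H \<union> S \<and> b \<in> H \<union> S \<and> is_instance \<delta> (temporal_triangle i) (a, b, e) \<and>
        card ({a, b} \<inter> H) = j})\<rparr>" for k
    by (rule step_state.equality) (simp_all add: heavy light fun_eq_iff counter[of _ _ k, symmetric] del: Un_iff)
  show ?thesis
    unfolding state step_edge_def Let_def H_def[symmetric] S_def[symmetric] by simp
qed

lemma step_run_eq_coins:
  assumes "sorted_wrt (\<lambda>e e'. time e < time e') \<tau>" and "\<delta> > 0"
  shows "step_run \<delta> \<O> p \<tau> =
    map_pmf (coin_state \<delta> \<O> \<tau>) (Pi_pmf (set \<tau>) False (\<lambda>_. bernoulli_pmf p))"
  using assms(1)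
proof (induction \<tau> rule: rev_induct)
  case Nil
  have "coin_state \<delta> \<O> [] (\<lambda>_. False) = step_init"
    by (auto simp: coin_state_def step_init_def instances_def fun_eq_iff card_eq_0_iff)
  then show ?case by (simp add: step_run_def)
next
  case (snoc e \<tau>)
  have e: "e \<notin> set \<tau>" and \<tau>: "sorted_wrt (\<lambda>e e'. time e < time e') \<tau>"
    using snoc.prems by (auto simp: sorted_wrt_append)
  let ?Pi = "Pi_pmf (set \<tau>) False (\<lambda>_. bernoulli_pmf p)"
  have "step_run \<delta> \<O> p (\<tau> @ [e]) = bind_pmf (step_run \<delta> \<O> p \<tau>) (step_edge \<delta> \<O> p e)"
    by (simp add: step_run_def)
  also have "\<dots> = bind_pmf ?Pi (\<lambda>B. bernoulli_pmf p \<bind>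
      (\<lambda>k. return_pmf (coin_state \<delta> \<O> (\<tau> @ [e]) (B(e := k)))))"
    unfolding snoc.IH[OF \<tau>] bind_map_pmf step_edge_coin_state[OF snoc.prems assms(2)]
    by (simp add: map_pmf_def)
  also have "\<dots> = map_pmf (coin_state \<delta> \<O> (\<tau> @ [e]))
      (Pi_pmf (insert e (set \<tau>)) False (\<lambda>_. bernoulli_pmf p))"
    by (subst Pi_pmf_insert'[OF _ e], simp)
      (simp add: map_pmf_def bind_assoc_pmf bind_return_pmf, rule bind_commute_pmf)
  finally show ?case by simp
qed

abbreviation coins :: "'a set \<Rightarrow> real \<Rightarrow> ('a \<Rightarrow> bool) pmf" where
  "coins A p \<equiv> Pi_pmf A False (\<lambda>_. bernoulli_pmf p)"

definition inverse_prob :: "('a \<Rightarrow> bool) \<Rightarrow> real \<Rightarrow> 'a \<Rightarrow> bool \<Rightarrow> real" where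
  "inverse_prob \<O> p x k = (if \<O> x then 1 else if k then 1 / p else 0)"

lemma finite_set_coins: "finite A \<Longrightarrow> finite (set_pmf (coins A p))"
  by (simp add: set_Pi_pmf finite_PiE_dflt)

lemma estimate_coin_state:
  "estimate p (coin_state \<delta> \<O> \<tau> B) i =
    (\<Sum>(a, b, c)\<in>instances \<delta> (set \<tau>) i. inverse_prob \<O> p a (B a) * inverse_prob \<O> p b (B b))"
proof -
  let ?I = "instances \<delta> (set \<tau>) i"
  define Q where "Q j = (\<lambda>(a, b, c :: 'a tedge). (\<O> a \<or> B a) \<and> (\<O> b \<or> B b) \<and> card ({a, b} \<inter> Collect \<O>) = j)"
    for j :: nat
  have fin: "finite ?I" by (rule finite_instances) simp
  have "counter (coin_state \<delta> \<O> \<tau> B) i j = card (?I \<inter> Collect (Q j))" for j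
    by (auto simp: coin_state_def Q_def intro!: arg_cong[where f = card])
  then have count: "real (counter (coin_state \<delta> \<O> \<tau> B) i j) = (\<Sum>x\<in>?I. of_bool (Q j x))" for j
    using fin by (simp add: Int_commute)
  have "estimate p (coin_state \<delta> \<O> \<tau> B) i =
    (\<Sum>x\<in>?I. of_bool (Q 0 x) / p\<^sup>2 + of_bool (Q 1 x) / p + of_bool (Q 2 x))"
    unfolding estimate_def count by (simp add: sum.distrib sum_divide_distrib)
  also have "\<dots> = (\<Sum>(a, b, c)\<in>?I. inverse_prob \<O> p a (B a) * inverse_prob \<O> p b (B b))"
  proof (rule sum.cong[OF refl], clarify)
    fix a b c :: "'a tedge"
    assume "(a, b, c) \<in> ?I"
    then have "a \<noteq> b" using instancesD(4) by blast
    then have "card ({a, b} \<inter> Collect \<O>) = of_bool (\<O> a) + of_bool (\<O> b)"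
      by (cases "\<O> a"; cases "\<O> b") auto
    then show "of_bool (Q 0 (a, b, c)) / p\<^sup>2 + of_bool (Q 1 (a, b, c)) / p + of_bool (Q 2 (a, b, c)) =
        inverse_prob \<O> p a (B a) * inverse_prob \<O> p b (B b)"
      unfolding Q_def inverse_prob_def
      by (cases "\<O> a"; cases "\<O> b"; cases "B a"; cases "B b")
        (simp_all add: power2_eq_square)
  qed
  finally show ?thesis .
qed

lemma expectation_prod_inverse_prob:
  fixes \<O> :: "'a \<Rightarrow> bool"
  assumes "finite A" and p: "0 < p" "p \<le> 1" and S: "S \<subseteq> A" "S' \<subseteq> A"
  defines "Y \<equiv> \<lambda>B x. inverse_prob \<O> p x (B x)"
  shows "measure_pmf.expectation (coins A p) (\<lambda>B. (\<Prod>x\<in>S. Y B x) * (\<Prod>x\<in>S'. Y B x)) =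
    (1 / p) ^ card {x \<in> S \<inter> S'. \<not> \<O> x}"
proof -
  define k where "k x = of_bool (x \<in> S) + (of_bool (x \<in> S') :: nat)" for x
  have restrict: "(\<Prod>x\<in>U. Y B x) = (\<Prod>x\<in>A. Y B x ^ of_bool (x \<in> U))" if "U \<subseteq> A" for U B
    using that assms(1) by (intro prod.mono_neutral_cong_left) auto
  have "measure_pmf.expectation (coins A p) (\<lambda>B. (\<Prod>x\<in>S. Y B x) * (\<Prod>x\<in>S'. Y B x)) =
    measure_pmf.expectation (coins A p) (\<lambda>B. \<Prod>x\<in>A. Y B x ^ k x)"
    by (simp only: restrict[OF S(1)] restrict[OF S(2)] prod.distrib k_def power_add)
  also have "\<dots> = (\<Prod>x\<in>A. measure_pmf.expectation (bernoulli_pmf p) (\<lambda>v. inverse_prob \<O> p x v ^ k x))"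
    using assms(1) p unfolding Y_def
    by (intro expectation_prod_Pi_pmf integrable_measure_pmf_finite) (auto simp: inverse_prob_def)
  also have "\<dots> = (\<Prod>x\<in>A. if x \<in> {x \<in> S \<inter> S'. \<not> \<O> x} then 1 / p else 1)"
    using p by (intro prod.cong refl) (auto simp: inverse_prob_def k_def power2_eq_square)
  also have "\<dots> = (1 / p) ^ card {x \<in> S \<inter> S'. \<not> \<O> x}"
  proof -
    have "A \<inter> {x \<in> S \<inter> S'. \<not> \<O> x} = {x \<in> S \<inter> S'. \<not> \<O> x}"
      using S by auto
    then show ?thesis
      using assms(1) by (simp only: prod.inter_restrict[symmetric] prod_constant)
  qed
  finally show ?thesis .
qed

lemma variance_sum_le:
  fixes Z :: "'i \<Rightarrow> 'b \<Rightarrow> real"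
  assumes fin: "finite (set_pmf M)" "finite I"
    and mean: "\<And>i. i \<in> I \<Longrightarrow> measure_pmf.expectation M (Z i) = 1"
    and prod: "\<And>i j. i \<in> I \<Longrightarrow> j \<in> I \<Longrightarrow>
      measure_pmf.expectation M (\<lambda>\<omega>. Z i \<omega> * Z j \<omega>) \<le> 1 + q * of_bool (R i j)"
  shows "measure_pmf.variance M (\<lambda>\<omega>. \<Sum>i\<in>I. Z i \<omega>) \<le> q * (\<Sum>i\<in>I. real (card {j \<in> I. R i j}))"
proof -
  have int: "integrable M f" for f :: "'b \<Rightarrow> real"
    by (rule integrable_measure_pmf_finite[OF fin(1)])
  have "measure_pmf.variance M (\<lambda>\<omega>. \<Sum>i\<in>I. Z i \<omega>) =
    measure_pmf.expectation M (\<lambda>\<omega>. (\<Sum>i\<in>I. Z i \<omega>)\<^sup>2) - (real (card I))\<^sup>2"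
    by (subst measure_pmf.variance_eq[OF int int]) (simp add: Bochner_Integration.integral_sum[OF int] mean)
  also have "\<dots> = (\<Sum>i\<in>I. \<Sum>j\<in>I. measure_pmf.expectation M (\<lambda>\<omega>. Z i \<omega> * Z j \<omega>) - 1)"
    by (simp add: power2_eq_square sum_product Bochner_Integration.integral_sum[OF int] sum_subtractf)
  also have "\<dots> \<le> (\<Sum>i\<in>I. \<Sum>j\<in>I. q * of_bool (R i j))"
    using prod by (intro sum_mono) (simp add: diff_le_eq add.commute)
  also have "\<dots> = q * (\<Sum>i\<in>I. real (card {j \<in> I. R i j}))"
    using fin(2) by (simp add: sum_distrib_left[symmetric] Int_def)
  finally show ?thesis .
qed

lemma card_window_le:
  assumes "finite E"
  shows "card {e \<in> E. t \<le> time e \<and> time e \<le> t + \<delta>} \<le> window_max \<delta> E"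
proof -
  have "finite (range (\<lambda>t. card {e \<in> E. t \<le> time e \<and> time e \<le> t + \<delta>}))"
    by (rule finite_subset[of _ "{..card E}"]) (auto intro!: card_mono assms)
  then show ?thesis unfolding window_max_def by (intro Max_ge) auto
qed

lemma card_instances_first_two_le:
  assumes "finite E"
  shows "card {(a, b, c). (a, b, c) \<in> instances \<delta> E i \<and> v \<in> {a, b}} \<le> 2 * (window_max \<delta> E)\<^sup>2"
proof -
  let ?W = "\<lambda>t. {e \<in> E. t \<le> time e \<and> time e \<le> t + \<delta>}"
  let ?t = "time v"
  have fin: "finite (?W t)" for t using assms by simp
  have "card {(a, b, c). (a, b, c) \<in> instances \<delta> E i \<and> v \<in> {a, b}} \<le>
      card ({v} \<times> ?W ?t \<times> ?W ?t \<union> ?W (?t - \<delta>) \<times> {v} \<times> ?W ?t)"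
  proof (rule card_mono)
    show "finite ({v} \<times> ?W ?t \<times> ?W ?t \<union> ?W (?t - \<delta>) \<times> {v} \<times> ?W ?t)"
      by (intro finite_UnI finite_cartesian_product fin) simp_all
    have "(a, b, c) \<in> {v} \<times> ?W ?t \<times> ?W ?t \<union> ?W (?t - \<delta>) \<times> {v} \<times> ?W ?t"
      if "(a, b, c) \<in> instances \<delta> E i" and v: "v \<in> {a, b}" for a b c
    proof (cases "v = a")
      case True
      with instancesD[OF that(1)] show ?thesis by simp
    next
      case False
      with v have "v = b" by simp
      with instancesD[OF that(1)] show ?thesis by simp
    qed
    then show "{(a, b, c). (a, b, c) \<in> instances \<delta> E i \<and> v \<in> {a, b}} \<subseteq>
        {v} \<times> ?W ?t \<times> ?W ?t \<union> ?W (?t - \<delta>) \<times> {v} \<times> ?W ?t"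
      by blast
  qed
  also have "\<dots> \<le> card (?W ?t) * card (?W ?t) + card (?W (?t - \<delta>)) * card (?W ?t)"
    by (rule order_trans[OF card_Un_le]) (simp add: card_cartesian_product)
  also have "\<dots> \<le> window_max \<delta> E * window_max \<delta> E + window_max \<delta> E * window_max \<delta> E"
    by (intro add_mono mult_mono card_window_le assms) simp_all
  finally show ?thesis by (simp add: power2_eq_square)
qed

lemma estimate_moments:
  fixes i :: nat
  assumes sorted: "sorted_wrt (\<lambda>e e'. time e < time e') \<tau>" and "\<delta> > 0" and p: "0 < p" "p \<le> 1"
  defines "T \<equiv> real (num_instances \<delta> (set \<tau>) i)"
  shows "measure_pmf.expectation (step_run \<delta> \<O> p \<tau>) (\<lambda>st. estimate p st i) = T" (is ?mean)
    and "measure_pmf.variance (step_run \<delta> \<O> p \<tau>) (\<lambda>st. estimate p st i)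
      \<le> 2 * T * sqrt (2 * T) * window_max \<delta> (set \<tau>) / p\<^sup>2" (is ?var)
proof -
  let ?E = "set \<tau>"
  let ?I = "instances \<delta> ?E i"
  let ?M = "coins ?E p"
  let ?m = "real (window_max \<delta> ?E)"
  define F :: "'a tedge \<times> 'a tedge \<times> 'a tedge \<Rightarrow> 'a tedge set" where "F = (\<lambda>(a, b, c). {a, b})"
  define Z where "Z x B = (\<Prod>y\<in>F x. inverse_prob \<O> p y (B y))" for x B
  have finI: "finite ?I" by (rule finite_instances) simp
  have finM: "finite (set_pmf ?M)" by (rule finite_set_coins) simp
  have T: "T = real (card ?I)" by (simp add: T_def num_instances_def)
  have F: "F x \<subseteq> ?E" if "x \<in> ?I" for x
    using that by (cases x) (auto simp: F_def dest: instancesD(1,2))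
  have est: "estimate p (coin_state \<delta> \<O> \<tau> B) i = (\<Sum>x\<in>?I. Z x B)" for B
    unfolding estimate_coin_state
  proof (rule sum.cong[OF refl], clarify)
    fix a b c :: "'a tedge"
    assume "(a, b, c) \<in> ?I"
    then have "a \<noteq> b" using instancesD(4) by blast
    then show "inverse_prob \<O> p a (B a) * inverse_prob \<O> p b (B b) = Z (a, b, c) B"
      by (simp add: Z_def F_def)
  qed
  have mean: "measure_pmf.expectation ?M (Z x) = 1" if "x \<in> ?I" for x
    using expectation_prod_inverse_prob[of ?E p "F x" "{}" \<O>] F[OF that] p
    by (simp add: Z_def[abs_def])
  have prod: "measure_pmf.expectation ?M (\<lambda>B. Z x B * Z y B) \<le> 1 + 1 / p\<^sup>2 * of_bool (F x \<inter> F y \<noteq> {})"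
    if x: "x \<in> ?I" and y: "y \<in> ?I" for x y
  proof -
    let ?c = "card {z \<in> F x \<inter> F y. \<not> \<O> z}"
    have eq: "measure_pmf.expectation ?M (\<lambda>B. Z x B * Z y B) = (1 / p) ^ ?c"
      unfolding Z_def using F[OF x] F[OF y] p by (intro expectation_prod_inverse_prob) simp_all
    show ?thesis
    proof (cases "F x \<inter> F y = {}")
      case True
      then show ?thesis by (simp add: eq)
    next
      case False
      obtain a b c where abc: "x = (a, b, c)" by (cases x)
      have "?c \<le> card {a, b}" by (rule card_mono) (auto simp: F_def abc)
      also have "\<dots> \<le> 2" by (simp add: card_insert_if)
      finally have "(1 / p) ^ ?c \<le> (1 / p) ^ 2"
        using p by (intro power_increasing) simp_all
      then show ?thesis using False by (simp add: eq power_divide)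
    qed
  qed
  have run: "measure_pmf.expectation (step_run \<delta> \<O> p \<tau>) f = measure_pmf.expectation ?M (\<lambda>B. f (coin_state \<delta> \<O> \<tau> B))"
    for f :: "'a step_state \<Rightarrow> real"
    by (simp add: step_run_eq_coins[OF sorted \<open>\<delta> > 0\<close>])
  show ?mean
    unfolding run est T
    by (subst Bochner_Integration.integral_sum[OF integrable_measure_pmf_finite[OF finM]]) (simp add: mean)
  let ?D = "\<lambda>v. card {y \<in> ?I. v \<in> F y}"
  have D: "real (?D v) \<le> sqrt (2 * T) * ?m" for v
  proof -
    have "{y \<in> ?I. v \<in> F y} = {(a, b, c). (a, b, c) \<in> ?I \<and> v \<in> {a, b}}"
      by (auto simp: F_def)
    then have "?D v \<le> 2 * (window_max \<delta> ?E)\<^sup>2"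
      using card_instances_first_two_le[of ?E \<delta> i v] by simp
    moreover have "?D v \<le> card ?I" by (rule card_mono[OF finI]) auto
    ultimately have "?D v * ?D v \<le> card ?I * (2 * (window_max \<delta> ?E)\<^sup>2)"
      by (intro mult_le_mono)
    then have "real (?D v * ?D v) \<le> real (card ?I * (2 * (window_max \<delta> ?E)\<^sup>2))"
      by (rule of_nat_mono)
    then have "(real (?D v))\<^sup>2 \<le> T * (2 * ?m\<^sup>2)"
      unfolding T power2_eq_square[of "real (?D v)"] of_nat_mult of_nat_power of_nat_numeral .
    also have "\<dots> = 2 * T * ?m\<^sup>2" by simp
    finally have "real (?D v) \<le> sqrt (2 * T * ?m\<^sup>2)"
      by (rule real_le_rsqrt)
    then show ?thesis by (simp add: real_sqrt_mult)
  qed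
  have overlap: "real (card {y \<in> ?I. F x \<inter> F y \<noteq> {}}) \<le> 2 * (sqrt (2 * T) * ?m)" if "x \<in> ?I" for x
  proof -
    obtain a b c where abc: "x = (a, b, c)" by (cases x)
    have "{y \<in> ?I. F x \<inter> F y \<noteq> {}} = {y \<in> ?I. a \<in> F y} \<union> {y \<in> ?I. b \<in> F y}"
      by (auto simp: F_def abc)
    then have "card {y \<in> ?I. F x \<inter> F y \<noteq> {}} \<le> ?D a + ?D b"
      by (simp only: card_Un_le)
    then have "real (card {y \<in> ?I. F x \<inter> F y \<noteq> {}}) \<le> real (?D a) + real (?D b)"
      by linarith
    with D[of a] D[of b] show ?thesis by linarith
  qed
  have "measure_pmf.variance ?M (\<lambda>B. \<Sum>x\<in>?I. Z x B)
      \<le> 1 / p\<^sup>2 * (\<Sum>x\<in>?I. real (card {y \<in> ?I. F x \<inter> F y \<noteq> {}}))"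
    by (rule variance_sum_le[OF finM finI mean prod])
  also have "\<dots> \<le> 1 / p\<^sup>2 * (\<Sum>x\<in>?I. 2 * (sqrt (2 * T) * ?m))"
    by (intro mult_left_mono sum_mono overlap) simp_all
  also have "\<dots> = 2 * T * sqrt (2 * T) * ?m / p\<^sup>2"
    by (simp add: T)
  finally show ?var
    unfolding run est .
qed

lemma prob_bind_pmf_le:
  assumes "\<And>x. x \<in> set_pmf M \<Longrightarrow> measure_pmf.prob (f x) S \<le> c" and "c \<ge> 0"
  shows "measure_pmf.prob (bind_pmf M f) S \<le> c"
proof -
  have "emeasure (bind_pmf M f) S = (\<integral>\<^sup>+x. emeasure (f x) S \<partial>M)"
    by simp
  also have "\<dots> \<le> (\<integral>\<^sup>+x. ennreal c \<partial>M)"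
    using assms by (intro nn_integral_mono_AE AE_pmfI)
      (simp add: measure_pmf.emeasure_eq_measure ennreal_leI)
  finally show ?thesis
    using assms(2) by (simp add: measure_pmf.emeasure_eq_measure)
qed

lemma finite_set_step_run:
  assumes "sorted_wrt (\<lambda>e e'. time e < time e') \<tau>" and "\<delta> > 0"
  shows "finite (set_pmf (step_run \<delta> \<O> p \<tau>))"
  by (simp add: step_run_eq_coins[OF assms] finite_set_coins)

lemma noisy_step_accuracy:
  fixes E :: "'v tedge set" and M \<Delta> :: real
  assumes stream: "is_stream E \<tau>" and "\<delta> > 0" and p: "0 < p" "p \<le> 1" and "\<epsilon> > 0"
    and T: "\<And>j. j \<in> {1..8} \<Longrightarrow> T j = real (num_instances \<delta> E j)" "\<And>j. j \<in> {1..8} \<Longrightarrow> T j > 0"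
    and balanced: "\<And>j. j \<in> {1..8} \<Longrightarrow> T i \<le> M * T j"
    and i: "i \<in> {1..8}" and M: "M \<ge> 1" and \<Delta>: "\<Delta> \<ge> 1"
    and rate: "10 * M * sqrt (\<Delta> * window_max \<delta> E) / (\<epsilon> * T i powr (1/4)) \<le> p"
  shows "measure_pmf.prob (noisy_step \<delta> es \<alpha> K p \<tau>)
    {st. \<exists>j\<in>{1..8}. \<bar>estimate p st j - T j\<bar> \<ge> \<epsilon> * T j} \<le> 1/3"
proof -
  have sorted: "sorted_wrt (\<lambda>e e'. time e < time e') \<tau>" and E: "set \<tau> = E"
    using stream by (auto simp: is_stream_def)
  let ?m = "real (window_max \<delta> E)"
  have Ti: "T i > 0" using T(2) i by blast
  have "10 * M * sqrt (\<Delta> * ?m) \<le> p * \<epsilon> * T i powr (1/4)"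
    using rate \<open>\<epsilon> > 0\<close> Ti by (simp add: field_simps)
  then have "(10 * M * sqrt (\<Delta> * ?m))\<^sup>2 \<le> (p * \<epsilon> * T i powr (1/4))\<^sup>2"
    using M \<Delta> by (intro power_mono) simp_all
  moreover have "(T i powr (1/4))\<^sup>2 = sqrt (T i)"
    using Ti by (simp add: power2_eq_square powr_add[symmetric] powr_half_sqrt)
  ultimately have rate': "100 * M\<^sup>2 * (\<Delta> * ?m) \<le> p\<^sup>2 * \<epsilon>\<^sup>2 * sqrt (T i)"
    using \<Delta> by (simp add: power_mult_distrib)
  have single: "measure_pmf.prob (step_run \<delta> \<O> p \<tau>) {st. \<bar>estimate p st j - T j\<bar> \<ge> \<epsilon> * T j} \<le> 1/24"
    if j: "j \<in> {1..8}" for \<O> j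
  proof -
    have Tj: "T j > 0" using T(2) j by blast
    have "M \<le> M\<^sup>2" using M by (simp add: self_le_power)
    then have "T i \<le> M\<^sup>2 * T j"
      using balanced[OF j] mult_right_mono[of M "M\<^sup>2" "T j"] Tj by linarith
    then have "sqrt (T i) \<le> sqrt (M\<^sup>2 * T j)" by simp
    also have "\<dots> = M * sqrt (T j)" using M by (simp add: real_sqrt_mult)
    finally have "p\<^sup>2 * \<epsilon>\<^sup>2 * sqrt (T i) \<le> p\<^sup>2 * \<epsilon>\<^sup>2 * (M * sqrt (T j))"
      by (intro mult_left_mono) simp_all
    with rate' have "M * (100 * M * (\<Delta> * ?m)) \<le> M * (p\<^sup>2 * \<epsilon>\<^sup>2 * sqrt (T j))"
      by (simp add: power2_eq_square algebra_simps)
    then have "100 * M * (\<Delta> * ?m) \<le> p\<^sup>2 * \<epsilon>\<^sup>2 * sqrt (T j)"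
      using M by simp
    moreover have "1 * (1 * ?m) \<le> M * (\<Delta> * ?m)"
      using M \<Delta> by (intro mult_mono) simp_all
    ultimately have m: "100 * ?m \<le> p\<^sup>2 * \<epsilon>\<^sup>2 * sqrt (T j)" by simp
    have "sqrt 2 \<le> 2" by (rule real_le_lsqrt) simp_all
    then have "2 * T j * sqrt (2 * T j) * ?m \<le> 2 * T j * (2 * sqrt (T j)) * (p\<^sup>2 * \<epsilon>\<^sup>2 * sqrt (T j) / 100)"
      using m Tj p by (intro mult_mono) (simp_all add: real_sqrt_mult)
    also have "\<dots> = p\<^sup>2 * (\<epsilon> * T j)\<^sup>2 / 25"
      using Tj by (simp add: power_mult_distrib power2_eq_square)
    also have "\<dots> \<le> p\<^sup>2 * (\<epsilon> * T j)\<^sup>2 / 24"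
      by (intro divide_left_mono) simp_all
    finally have bound: "2 * T j * sqrt (2 * T j) * ?m / p\<^sup>2 / (\<epsilon> * T j)\<^sup>2 \<le> 1/24"
      using p Tj \<open>\<epsilon> > 0\<close> by (simp add: field_simps)
    let ?R = "step_run \<delta> \<O> p \<tau>"
    have "\<epsilon> * T j > 0" using Tj \<open>\<epsilon> > 0\<close> by simp
    then have "measure_pmf.prob ?R {st \<in> space ?R.
        \<epsilon> * T j \<le> \<bar>estimate p st j - measure_pmf.expectation ?R (\<lambda>st. estimate p st j)\<bar>}
      \<le> measure_pmf.variance ?R (\<lambda>st. estimate p st j) / (\<epsilon> * T j)\<^sup>2"
      by (intro measure_pmf.Chebyshev_inequality integrable_measure_pmf_finite finite_set_step_run
          sorted \<open>\<delta> > 0\<close>) simp_all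
    also have "\<dots> \<le> 2 * T j * sqrt (2 * T j) * ?m / p\<^sup>2 / (\<epsilon> * T j)\<^sup>2"
      using estimate_moments(2)[OF sorted \<open>\<delta> > 0\<close> p, of \<O> j]
      by (intro divide_right_mono) (simp_all add: E T(1)[OF j])
    also note bound
    finally show ?thesis
      by (simp add: estimate_moments(1)[OF sorted \<open>\<delta> > 0\<close> p] E T(1)[OF j])
  qed
  have "measure_pmf.prob (step_run \<delta> \<O> p \<tau>)
      {st. \<exists>j\<in>{1..8}. \<bar>estimate p st j - T j\<bar> \<ge> \<epsilon> * T j} \<le> 1/3" for \<O>
  proof -
    have "measure_pmf.prob (step_run \<delta> \<O> p \<tau>)
        {st. \<exists>j\<in>{1..8}. \<bar>estimate p st j - T j\<bar> \<ge> \<epsilon> * T j} =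
      measure_pmf.prob (step_run \<delta> \<O> p \<tau>)
        (\<Union>j\<in>{1..8}. {st. \<bar>estimate p st j - T j\<bar> \<ge> \<epsilon> * T j})"
      by (rule arg_cong[where f = "measure_pmf.prob _"]) auto
    also have "\<dots> \<le> (\<Sum>j\<in>{1..8}. measure_pmf.prob (step_run \<delta> \<O> p \<tau>)
        {st. \<bar>estimate p st j - T j\<bar> \<ge> \<epsilon> * T j})"
      by (rule measure_pmf.finite_measure_subadditive_finite) simp_all
    also have "\<dots> \<le> (\<Sum>j\<in>{1..8::nat}. 1/24)"
      by (rule sum_mono) (rule single)
    finally show ?thesis by simp
  qed
  then show ?thesis
    unfolding noisy_step_def by (intro prob_bind_pmf_le) simp_all
qed

lemma expected_memory_step_run:
  assumes sorted: "sorted_wrt (\<lambda>e e'. time e < time e') \<tau>" and "\<delta> > 0" and p: "0 < p" "p \<le> 1"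
    and E: "finite E" "set \<tau> \<subseteq> E" and heavy: "finite (Collect \<O>)" "card (Collect \<O>) \<le> K"
  shows "measure_pmf.expectation (step_run \<delta> \<O> p \<tau>) (\<lambda>st. real (memory st))
    \<le> real K + p * window_max \<delta> E + 24"
proof -
  let ?M = "coins (set \<tau>) p"
  define L where "L = {x \<in> set \<tau>. \<not> time x < time (last \<tau>) - \<delta>}"
  have int: "integrable ?M f" for f :: "_ \<Rightarrow> real"
    by (intro integrable_measure_pmf_finite finite_set_coins) simp
  have finL: "finite L" by (simp add: L_def)
  have last: "time x \<le> time (last \<tau>)" if "x \<in> set \<tau>" for x
    using sorted that by (induction \<tau> rule: rev_induct) (auto simp: sorted_wrt_append)
  have "card L \<le> card {e \<in> E. time (last \<tau>) - \<delta> \<le> time e \<and> time e \<le> time (last \<tau>) - \<delta> + \<delta>}"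
    using E last by (intro card_mono) (auto simp: L_def)
  also have "\<dots> \<le> window_max \<delta> E" by (rule card_window_le[OF E(1)])
  finally have L: "card L \<le> window_max \<delta> E" .
  have mem: "real (memory (coin_state \<delta> \<O> \<tau> B)) \<le> real K + 24 + (\<Sum>x\<in>L. of_bool (B x))" for B
  proof -
    let ?st = "coin_state \<delta> \<O> \<tau> B"
    have "card (heavy ?st) \<le> card (Collect \<O>)"
      using heavy(1) by (intro card_mono) (auto simp: coin_state_def)
    moreover have "card (light ?st) \<le> card (L \<inter> Collect B)"
      using finL by (intro card_mono) (auto simp: coin_state_def L_def)
    ultimately have "memory ?st \<le> K + card (L \<inter> Collect B) + 24"
      using card_Un_le[of "heavy ?st" "light ?st"] heavy(2) unfolding memory_def by linarith
    then have "real (memory ?st) \<le> real (K + card (L \<inter> Collect B) + 24)"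
      by (rule of_nat_mono)
    then show ?thesis using finL by simp
  qed
  have coin: "measure_pmf.expectation ?M (\<lambda>B. of_bool (B x)) = p" if "x \<in> L" for x
  proof -
    have "measure_pmf.expectation ?M (\<lambda>B. of_bool (B x)) =
        measure_pmf.expectation (map_pmf (\<lambda>B. B x) ?M) (of_bool :: bool \<Rightarrow> real)"
      by simp
    also have "\<dots> = p"
      using that p by (subst Pi_pmf_component) (simp_all add: L_def)
    finally show ?thesis .
  qed
  have "measure_pmf.expectation (step_run \<delta> \<O> p \<tau>) (\<lambda>st. real (memory st)) =
      measure_pmf.expectation ?M (\<lambda>B. real (memory (coin_state \<delta> \<O> \<tau> B)))"
    by (simp add: step_run_eq_coins[OF sorted \<open>\<delta> > 0\<close>])
  also have "\<dots> \<le> measure_pmf.expectation ?M (\<lambda>B. real K + 24 + (\<Sum>x\<in>L. of_bool (B x)))"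
    by (rule integral_mono[OF int int mem])
  also have "\<dots> = real K + 24 + (\<Sum>x\<in>L. measure_pmf.expectation ?M (\<lambda>B. of_bool (B x)))"
    by (subst Bochner_Integration.integral_add[OF int int]) (simp add: Bochner_Integration.integral_sum[OF int])
  also have "\<dots> = real K + 24 + p * card L"
    by (simp add: coin)
  also have "\<dots> \<le> real K + 24 + p * window_max \<delta> E"
    using L p by (intro add_left_mono mult_left_mono) simp_all
  finally show ?thesis by simp
qed

lemma expected_memory_bounds:
  assumes stream: "is_stream E \<tau>" and "\<delta> > 0" and p: "0 < p" "p \<le> 1"
  shows "0 \<le> expected_memory \<delta> es \<alpha> K p \<tau>"
    and "expected_memory \<delta> es \<alpha> K p \<tau> \<le> real K + p * window_max \<delta> E + 24"
proof -
  let ?P = "noisy_perms (length es) \<alpha> K"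
  let ?f = "\<lambda>k. measure_pmf.expectation (noisy_step \<delta> es \<alpha> K p (take k \<tau>)) (\<lambda>st. real (memory st))"
  have "0 \<le> ?f 0" by (rule Bochner_Integration.integral_nonneg) simp
  also have "?f 0 \<le> expected_memory \<delta> es \<alpha> K p \<tau>"
    unfolding expected_memory_def by (intro Max_ge finite_imageI imageI) simp_all
  finally show "0 \<le> expected_memory \<delta> es \<alpha> K p \<tau>" .
  have P: "finite ?P" "?P \<noteq> {}"
  proof -
    show "finite ?P"
      by (rule finite_subset[OF _ finite_permutations[of "{1..length es}"]]) (auto simp: noisy_perms_def)
    have "id \<in> ?P" by (auto simp: noisy_perms_def permutes_id)
    then show "?P \<noteq> {}" by blast
  qed
  have "?f k \<le> real K + p * window_max \<delta> E + 24" for k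
  proof -
    have sorted: "sorted_wrt (\<lambda>e e'. time e < time e') (take k \<tau>)" and sub: "set (take k \<tau>) \<subseteq> E"
      using stream set_take_subset[of k \<tau>] by (auto simp: is_stream_def sorted_wrt_take)
    have finE: "finite E" using stream by (auto simp: is_stream_def)
    have le: "measure_pmf.expectation (step_run \<delta> (ranking_predictor es K \<pi>) p (take k \<tau>))
        (\<lambda>st. real (memory st)) \<le> real K + p * window_max \<delta> E + 24" for \<pi>
    proof (rule expected_memory_step_run[OF sorted \<open>\<delta> > 0\<close> p finE sub])
      have img: "Collect (ranking_predictor es K \<pi>) = (\<lambda>j. es ! (\<pi> j - 1)) ` {1..K}"
        unfolding ranking_predictor_def by blast
      show "finite (Collect (ranking_predictor es K \<pi>))" unfolding img by simp
      show "card (Collect (ranking_predictor es K \<pi>)) \<le> K"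
        unfolding img using card_image_le[of "{1..K}"] by simp
    qed
    have "?f k = (\<Sum>\<pi>\<in>?P. measure_pmf.expectation
        (step_run \<delta> (ranking_predictor es K \<pi>) p (take k \<tau>)) (\<lambda>st. real (memory st)) /\<^sub>R real (card ?P))"
      unfolding noisy_step_def
      by (rule pmf_expectation_bind_pmf_of_set[OF P(2,1) finite_set_step_run[OF sorted \<open>\<delta> > 0\<close>]])
    also have "\<dots> \<le> (\<Sum>\<pi>\<in>?P. (real K + p * window_max \<delta> E + 24) /\<^sub>R real (card ?P))"
      by (intro sum_mono scaleR_left_mono le) simp
    also have "\<dots> = real K + p * window_max \<delta> E + 24"
      using P by simp
    finally show ?thesis .
  qed
  then show "expected_memory \<delta> es \<alpha> K p \<tau> \<le> real K + p * window_max \<delta> E + 24"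
    unfolding expected_memory_def by (subst Max_le_iff) auto
qed

lemma max_gap_ge_1:
  assumes "length es \<ge> 2" and "max_gap \<delta> E es > 0"
  shows "max_gap \<delta> E es \<ge> 1"
proof -
  let ?g = "\<lambda>j. real (weight \<delta> E (es ! (j - 1))) - real (weight \<delta> E (es ! j))"
  have "max_gap \<delta> E es \<in> ?g ` {1..length es - 1}"
    unfolding max_gap_def using assms(1) by (intro Max_in) auto
  then obtain j where j: "max_gap \<delta> E es = ?g j" by blast
  with assms(2) have "weight \<delta> E (es ! j) < weight \<delta> E (es ! (j - 1))" by simp
  then show ?thesis unfolding j by linarith
qed

theorem theorem2:
  fixes C\<^sub>0 :: real
  shows "\<exists>C \<gamma> :: real. C > 0 \<and> 0 < \<gamma> \<and> \<gamma> < 1/2 \<and>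
    (\<forall>(V :: nat \<Rightarrow> 'v set) (E :: nat \<Rightarrow> 'v tedge set) (\<tau> :: nat \<Rightarrow> 'v tedge list)
      (\<delta> :: nat \<Rightarrow> real) (es :: nat \<Rightarrow> 'v tedge list) (\<alpha> :: nat \<Rightarrow> nat) (K :: nat \<Rightarrow> nat)
      (\<epsilon> :: nat \<Rightarrow> real) (p :: nat \<Rightarrow> real) (T :: nat \<Rightarrow> nat \<Rightarrow> real) (m\<^sub>\<delta> :: nat \<Rightarrow> real)
      (\<Delta>\<^sub>\<alpha> :: nat \<Rightarrow> real) (i :: nat) (rate :: nat \<Rightarrow> real) (bound :: nat \<Rightarrow> real).
      (\<forall>n. temporal_graph (V n) (E n) \<and> is_stream (E n) (\<tau> n) \<and> \<delta> n > 0) \<longrightarrow>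
      (\<forall>n. \<forall>j\<in>{1..8}. T n j = real (num_instances (\<delta> n) (E n) j) \<and> T n j > 0) \<longrightarrow>
      (\<forall>n. \<forall>j\<in>{1..8}. \<forall>k\<in>{1..8}. T n j \<le> C\<^sub>0 * T n k) \<longrightarrow>
      (\<forall>n. m\<^sub>\<delta> n = real (window_max (\<delta> n) (E n))) \<longrightarrow>
      (\<forall>n. weight_ordering (\<delta> n) (E n) (es n)) \<longrightarrow>
      (\<forall>n. max_gap (\<delta> n) (E n) (es n) > 0 \<and>
           \<Delta>\<^sub>\<alpha> n = max_gap (\<delta> n) (E n) (es n) * (real (\<alpha> n) + 1)) \<longrightarrow>
      (\<forall>n. K n > 0 \<and> \<alpha> n \<ge> 1 \<and>
           int (\<alpha> n) \<le> min (int (card (E n)) - int (K n) + 1) (int (K n) - 1)) \<longrightarrow>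
      (\<lambda>n. real (K n)) \<in> o(m\<^sub>\<delta>) \<longrightarrow>
      (\<forall>n. \<epsilon> n > 0 \<and> 0 < p n \<and> p n \<le> 1) \<longrightarrow>
      i \<in> {1..8} \<longrightarrow>
      (\<forall>n. rate n = C * sqrt (\<Delta>\<^sub>\<alpha> n * m\<^sub>\<delta> n) / (\<epsilon> n * T n i powr (1/2 - \<gamma>))) \<longrightarrow>
      (\<forall>n. bound n = (1 / \<epsilon> n) * m\<^sub>\<delta> n powr (3/2) * sqrt (\<Delta>\<^sub>\<alpha> n) / T n i powr (1/2 - \<gamma>)) \<longrightarrow>
      (\<forall>n. p n \<ge> rate n) \<longrightarrow>
      (\<forall>n. measure_pmf.prob (noisy_step (\<delta> n) (es n) (\<alpha> n) (K n) (p n) (\<tau> n))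
             {st. \<exists>j\<in>{1..8}. \<bar>estimate (p n) st j - T n j\<bar> \<ge> \<epsilon> n * T n j} \<le> 1/3) \<and>
      (p \<in> O(rate) \<longrightarrow>
        (\<lambda>n. expected_memory (\<delta> n) (es n) (\<alpha> n) (K n) (p n) (\<tau> n)) \<in> O(\<lambda>n. real (K n) + bound n) \<and>
        ((\<lambda>n. real (K n)) \<in> O(\<lambda>n. p n * m\<^sub>\<delta> n) \<longrightarrow>
         (\<lambda>n. expected_memory (\<delta> n) (es n) (\<alpha> n) (K n) (p n) (\<tau> n)) \<in> O(bound))))"
proof (rule exI[of _ "10 * max 1 C\<^sub>0"], rule exI[of _ "1/4"], intro conjI allI impI)
  show "10 * max 1 C\<^sub>0 > 0" "0 < (1/4 :: real)" "(1/4 :: real) < 1/2" by simp_all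
next
  fix V :: "nat \<Rightarrow> 'v set" and E :: "nat \<Rightarrow> 'v tedge set" and \<tau> \<delta> es \<alpha> K \<epsilon> p
    and T :: "nat \<Rightarrow> nat \<Rightarrow> real" and m\<^sub>\<delta> \<Delta>\<^sub>\<alpha> :: "nat \<Rightarrow> real" and i and rate bound :: "nat \<Rightarrow> real"
  assume graph: "\<forall>n. temporal_graph (V n) (E n) \<and> is_stream (E n) (\<tau> n) \<and> \<delta> n > 0"
    and T: "\<forall>n. \<forall>j\<in>{1..8}. T n j = real (num_instances (\<delta> n) (E n) j) \<and> T n j > 0"
    and balanced: "\<forall>n. \<forall>j\<in>{1..8}. \<forall>k\<in>{1..8}. T n j \<le> C\<^sub>0 * T n k"
    and m: "\<forall>n. m\<^sub>\<delta> n = real (window_max (\<delta> n) (E n))"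
    and es: "\<forall>n. weight_ordering (\<delta> n) (E n) (es n)"
    and gap: "\<forall>n. max_gap (\<delta> n) (E n) (es n) > 0 \<and>
           \<Delta>\<^sub>\<alpha> n = max_gap (\<delta> n) (E n) (es n) * (real (\<alpha> n) + 1)"
    and K: "\<forall>n. K n > 0 \<and> \<alpha> n \<ge> 1 \<and>
           int (\<alpha> n) \<le> min (int (card (E n)) - int (K n) + 1) (int (K n) - 1)"
    and p: "\<forall>n. \<epsilon> n > 0 \<and> 0 < p n \<and> p n \<le> 1"
    and i: "i \<in> {1..8}"
    and rate: "\<forall>n. rate n = 10 * max 1 C\<^sub>0 * sqrt (\<Delta>\<^sub>\<alpha> n * m\<^sub>\<delta> n) / (\<epsilon> n * T n i powr (1/2 - 1/4))"
    and bound: "\<forall>n. bound n = (1 / \<epsilon> n) * m\<^sub>\<delta> n powr (3/2) * sqrt (\<Delta>\<^sub>\<alpha> n) / T n i powr (1/2 - 1/4)"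
    and p_ge: "\<forall>n. p n \<ge> rate n"
  have \<Delta>: "\<Delta>\<^sub>\<alpha> n \<ge> 1" for n
  proof -
    have "length (es n) = card (E n)"
      using spec[OF es, of n] distinct_card[of "es n"] by (simp add: weight_ordering_def)
    moreover have "2 \<le> K n" "K n + \<alpha> n \<le> card (E n) + 1" "1 \<le> \<alpha> n"
      using spec[OF K, of n] by auto
    ultimately have "max_gap (\<delta> n) (E n) (es n) \<ge> 1"
      using gap by (intro max_gap_ge_1) simp_all
    then have "1 * 1 \<le> max_gap (\<delta> n) (E n) (es n) * (real (\<alpha> n) + 1)"
      by (intro mult_mono) simp_all
    then show ?thesis using gap by simp
  qed
  show "measure_pmf.prob (noisy_step (\<delta> n) (es n) (\<alpha> n) (K n) (p n) (\<tau> n))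
      {st. \<exists>j\<in>{1..8}. \<bar>estimate (p n) st j - T n j\<bar> \<ge> \<epsilon> n * T n j} \<le> 1/3" for n
  proof (rule noisy_step_accuracy[where T = "T n" and M = "max 1 C\<^sub>0" and \<Delta> = "\<Delta>\<^sub>\<alpha> n" and i = i])
    show "T n i \<le> max 1 C\<^sub>0 * T n j" if j: "j \<in> {1..8}" for j
    proof -
      have "T n i \<le> C\<^sub>0 * T n j" using balanced i j by blast
      also have "\<dots> \<le> max 1 C\<^sub>0 * T n j"
        using T j by (intro mult_right_mono) (auto intro: less_imp_le)
      finally show ?thesis .
    qed
    show "10 * max 1 C\<^sub>0 * sqrt (\<Delta>\<^sub>\<alpha> n * window_max (\<delta> n) (E n)) / (\<epsilon> n * T n i powr (1/4)) \<le> p n"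
      using spec[OF p_ge, of n] spec[OF rate, of n] m by simp
  qed (use graph p T \<Delta> i in \<open>blast | simp\<close>)+
  assume p_rate: "p \<in> O(rate)"
  let ?mem = "\<lambda>n. expected_memory (\<delta> n) (es n) (\<alpha> n) (K n) (p n) (\<tau> n)"
  have bound_nonneg: "bound n \<ge> 0" for n
    using p \<Delta>[of n] bound by (simp add: less_imp_le)
  have mem: "?mem \<in> O(\<lambda>n. real (K n) + p n * m\<^sub>\<delta> n)"
  proof (rule bigoI[of _ 25], rule always_eventually, rule allI)
    fix n
    have "0 \<le> ?mem n" "?mem n \<le> real (K n) + p n * m\<^sub>\<delta> n + 24"
      using expected_memory_bounds[of "E n" "\<tau> n" "\<delta> n" "p n" "es n" "\<alpha> n" "K n"] graph p m by simp_all
    moreover have "1 \<le> real (K n)" "0 \<le> p n * m\<^sub>\<delta> n"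
      using spec[OF K, of n] spec[OF p, of n] m by auto
    ultimately show "norm (?mem n) \<le> 25 * norm (real (K n) + p n * m\<^sub>\<delta> n)"
      by (simp add: abs_of_nonneg)
  qed
  have p_bound: "(\<lambda>n. p n * m\<^sub>\<delta> n) \<in> O(bound)"
  proof -
    have "rate n * m\<^sub>\<delta> n = 10 * max 1 C\<^sub>0 * bound n" for n
    proof -
      have "m\<^sub>\<delta> n powr (3/2) = sqrt (m\<^sub>\<delta> n) * m\<^sub>\<delta> n"
      proof -
        have "m\<^sub>\<delta> n \<ge> 0" using m by simp
        moreover have "m\<^sub>\<delta> n powr (3/2) = m\<^sub>\<delta> n powr (1/2) * m\<^sub>\<delta> n powr 1"
          by (subst powr_add[symmetric]) simp
        ultimately show ?thesis by (simp add: powr_half_sqrt)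
      qed
      then show ?thesis
        unfolding spec[OF rate, of n] spec[OF bound, of n]
        by (simp only: real_sqrt_mult) (simp add: ac_simps)
    qed
    then have "(\<lambda>n. rate n * m\<^sub>\<delta> n) \<in> O(bound)" by simp
    moreover have "(\<lambda>n. p n * m\<^sub>\<delta> n) \<in> O(\<lambda>n. rate n * m\<^sub>\<delta> n)"
      by (intro landau_o.big.mult p_rate) simp
    ultimately show ?thesis by (rule landau_o.big_trans[rotated])
  qed
  show "?mem \<in> O(\<lambda>n. real (K n) + bound n)"
  proof (rule landau_o.big_trans[OF mem], rule sum_in_bigo)
    show "(\<lambda>n. real (K n)) \<in> O(\<lambda>n. real (K n) + bound n)"
      by (rule bigoI[of _ 1]) (use bound_nonneg in simp)
    have "bound \<in> O(\<lambda>n. real (K n) + bound n)"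
      by (rule bigoI[of _ 1]) (use bound_nonneg in simp)
    with p_bound show "(\<lambda>n. p n * m\<^sub>\<delta> n) \<in> O(\<lambda>n. real (K n) + bound n)"
      by (rule landau_o.big_trans)
  qed
  assume "(\<lambda>n. real (K n)) \<in> O(\<lambda>n. p n * m\<^sub>\<delta> n)"
  then have "(\<lambda>n. real (K n)) \<in> O(bound)"
    using p_bound by (rule landau_o.big_trans)
  with p_bound show "?mem \<in> O(bound)"
    by (intro landau_o.big_trans[OF mem] sum_in_bigo)
qed

end
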